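(* Let $\mathbb{K}$ be $\mathbb{C}$ or $\mathbb{R}$ and let $\mathfrak{h}_2$ be the $5$-dimensional Heisenberg Lie algebra over $\mathbb{K}$ with basis $\{e_1,\dots,e_5\}$ and nonzero brackets $[e_1,e_3]=e_5$, $[e_2,e_4]=e_5$ (up to skew-symmetry). Define three skew-symmetric bilinear maps $\phi_1,\phi_2,\phi_3:\mathfrak{h}_2\times\mathfrak{h}_2\to\mathfrak{h}_2$ by the following values on pairs $(e_i,e_j)$ with $i<j$, all values not listed being zero: - $\phi_1(e_1,e_3)=2e_2-2e_3$, $\phi_1(e_1,e_4)=e_3$, $\phi_1(e_2,e_4)=e_2$, $\phi_1(e_3,e_4)=2e_3-e_2$; - $\phi_2(e_1,e_3)=e_1$, $\phi_2(e_1,e_4)=-e_2$, $\phi_2(e_2,e_3)=2e_2$, $\phi_2(e_3,e_4)=-e_4$, $\phi_2(e_3,e_5)=-3e_5$; - $\phi_3(e_1,e_4)=e_1$, $\phi_3(e_2,e_4)=e_2$, $\phi_3(e_3,e_4)=e_3$, $\phi_3(e_4,e_5)=-2e_5$. Then for each $i\in\{1,2,3\}$ the map $\phi_i$ is a $2$-cocycle of $\mathfrak{h}_2$ with adjoint coefficients, and $\mu_t(d_i)=[-,-]+t\phi_i$ is an infinitesimal deformation of $\mathfrak{h}_2$ which is also a real deformation. Explicitly, the nonzero brackets (up to skew-symmetry) of these deformations are: - $\mu_t(d_1)$: $[e_1,e_3]_t=e_5+t(2e_2-2e_3)$, $[e_1,e_4]_t=te_3$, $[e_2,e_4]_t=e_5+te_2$,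 $[e_3,e_4]_t=t(2e_3-e_2)$; - $\mu_t(d_2)$: $[e_1,e_3]_t=e_5+te_1$, $[e_1,e_4]_t=-te_2$, $[e_2,e_3]_t=2te_2$, $[e_2,e_4]_t=e_5$, $[e_3,e_4]_t=-te_4$, $[e_3,e_5]_t=-3te_5$; - $\mu_t(d_3)$: $[e_1,e_3]_t=e_5$, $[e_1,e_4]_t=te_1$, $[e_2,e_4]_t=e_5+te_2$, $[e_3,e_4]_t=te_3$, $[e_4,e_5]_t=-2te_5$.
   Context: For a Lie algebra $(\mathfrak{g},[-,-])$ over $\mathbb{K}$, $C^q(\mathfrak{g},\mathfrak{g})=\mathrm{Hom}_{\mathbb{K}}(\Lambda^q\mathfrak{g},\mathfrak{g})$ is the Chevalley--Eilenberg cochain space with adjoint coefficients, with differential $d$. A $2$-cochain $\phi$ is a $2$-cocycle iff the cyclic sum over $(x,y,z)$ of $[x,\phi(y,z)]+\phi(x,[y,z])$ vanishes for all $x,y,z\in\mathfrak{g}$. Given a $2$-cochain $\phi$, extend the bracket $[-,-]_t=[-,-]+t\phi$ to $\mathfrak{g}[[t]]$ by $\mathbb{K}[[t]]$-bilinearity. It is called an infinitesimal deformation of $\mathfrak{g}$ if it satisfies the Jacobi identity modulo $t^2$ (equivalently, $\phi$ is a $2$-cocycle), and a real deformation if it satisfies the Jacobi identity in every order of $t$, i.e. if it is a Lie bracket on the $\mathbb{K}[[t]]$-module $\mathfrak{g}[[t]]$. (The word "real" here does not refer to the field $\mathbb{R}$.) *)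

theory Defs
  imports "HOL-Analysis.Analysis" "HOL-Computational_Algebra.Formal_Power_Series"
begin

unbundle no vec_syntax
unbundle no fps_syntax

section \<open>Lie brackets and the Chevalley--Eilenberg differential in degree 2\<close>

text \<open>
  A module over a commutative ring \<open>'k\<close> is given by its scalar multiplication \<open>s\<close>, as in
  the locale \<^locale>\<open>module\<close>.  The module axioms themselves are part of
  \<^const>\<open>module_hom\<close>.
\<close>

definition alternating_bilinear ::
  "('k::comm_ring_1 \<Rightarrow> 'g::ab_group_add \<Rightarrow> 'g) \<Rightarrow> ('g \<Rightarrow> 'g \<Rightarrow> 'g) \<Rightarrow> bool" where
  "alternating_bilinear s f \<longleftrightarrow>
     (\<forall>y. module_hom s s (\<lambda>x. f x y)) \<and> (\<forall>x. module_hom s s (\<lambda>y. f x y)) \<and> (\<forall>x. f x x = 0)"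

definition jacobiator :: "('g::ab_group_add \<Rightarrow> 'g \<Rightarrow> 'g) \<Rightarrow> 'g \<Rightarrow> 'g \<Rightarrow> 'g \<Rightarrow> 'g" where
  "jacobiator br x y z = br x (br y z) + br y (br z x) + br z (br x y)"

definition lie_bracket ::
  "('k::comm_ring_1 \<Rightarrow> 'g::ab_group_add \<Rightarrow> 'g) \<Rightarrow> ('g \<Rightarrow> 'g \<Rightarrow> 'g) \<Rightarrow> bool" where
  "lie_bracket s br \<longleftrightarrow> alternating_bilinear s br \<and> (\<forall>x y z. jacobiator br x y z = 0)"

definition ce_diff2 ::
  "('g::ab_group_add \<Rightarrow> 'g \<Rightarrow> 'g) \<Rightarrow> ('g \<Rightarrow> 'g \<Rightarrow> 'g) \<Rightarrow> 'g \<Rightarrow> 'g \<Rightarrow> 'g \<Rightarrow> 'g" where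
  "ce_diff2 br \<phi> x y z =
     br x (\<phi> y z) - br y (\<phi> x z) + br z (\<phi> x y)
     - \<phi> (br x y) z + \<phi> (br x z) y - \<phi> (br y z) x"

definition two_cocycle ::
  "('k::comm_ring_1 \<Rightarrow> 'g::ab_group_add \<Rightarrow> 'g) \<Rightarrow> ('g \<Rightarrow> 'g \<Rightarrow> 'g) \<Rightarrow> ('g \<Rightarrow> 'g \<Rightarrow> 'g) \<Rightarrow> bool" where
  "two_cocycle s br \<phi> \<longleftrightarrow>
     lie_bracket s br \<and> alternating_bilinear s \<phi> \<and> (\<forall>x y z. ce_diff2 br \<phi> x y z = 0)"

lemma alternating_bilinear_skew:
  assumes "alternating_bilinear s f"
  shows "f x y = - f y x"
proof -
  have l: "f (a + b) c = f a c + f b c" and r: "f c (a + b) = f c a + f c b"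
    and z: "f a a = 0" for a b c
    using assms by (auto simp: alternating_bilinear_def module_hom_iff)
  have "f (x + y) (x + y) = f x y + f y x"
    unfolding l r by (simp add: z)
  then have "f x y + f y x = 0"
    unfolding z by (rule sym)
  then show ?thesis
    by (simp add: eq_neg_iff_add_eq_0)
qed

lemma two_cocycle_iff_cyclic_sum:
  assumes "lie_bracket s br" "alternating_bilinear s \<phi>"
  shows "two_cocycle s br \<phi> \<longleftrightarrow>
    (\<forall>x y z. (br x (\<phi> y z) + \<phi> x (br y z)) + (br y (\<phi> z x) + \<phi> y (br z x))
           + (br z (\<phi> x y) + \<phi> z (br x y)) = 0)"
proof -
  have bneg: "br a (- b) = - br a b" for a b
    using assms(1) module_hom.neg
    unfolding lie_bracket_def alternating_bilinear_def by blast
  have pneg: "\<phi> a (- b) = - \<phi> a b" for a b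
    using assms(2) module_hom.neg unfolding alternating_bilinear_def by blast
  have bs: "br a b = - br b a" and ps: "\<phi> a b = - \<phi> b a" for a b
    using assms alternating_bilinear_skew unfolding lie_bracket_def by blast+
  have "ce_diff2 br \<phi> x y z =
      (br x (\<phi> y z) + \<phi> x (br y z)) + (br y (\<phi> z x) + \<phi> y (br z x))
      + (br z (\<phi> x y) + \<phi> z (br x y))" for x y z
  proof -
    have "br y (\<phi> x z) = - br y (\<phi> z x)" "\<phi> (br x z) y = \<phi> y (br z x)"
      by (metis bneg ps, metis bs ps pneg minus_minus)
    moreover have "\<phi> (br x y) z = - \<phi> z (br x y)" "\<phi> (br y z) x = - \<phi> x (br y z)"
      using ps by blast+
    ultimately show ?thesis by (simp add: ce_diff2_def)
  qed
  then show ?thesis using assms by (simp add: two_cocycle_def)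
qed

section \<open>Deformations over formal power series\<close>

text \<open>
  \<open>'g[[t]]\<close> is the type \<open>'g fps\<close>; the indeterminate \<open>t\<close> is \<^const>\<open>fps_X\<close>, and
  \<^const>\<open>fps_const\<close> embeds \<open>'g\<close> into \<open>'g[[t]]\<close>.
  Scalar multiplication by \<open>'k[[t]]\<close>, and the \<open>'k[[t]]\<close>-bilinear extension of a bilinear
  map of \<open>'g\<close>, are Cauchy products.
\<close>

definition fps_scale ::
  "('k::comm_ring_1 \<Rightarrow> 'g::ab_group_add \<Rightarrow> 'g) \<Rightarrow> 'k fps \<Rightarrow> 'g fps \<Rightarrow> 'g fps" where
  "fps_scale s a x = Abs_fps (\<lambda>n. \<Sum>i\<le>n. s (fps_nth a i) (fps_nth x (n - i)))"

definition fps_bilin :: "('g::ab_group_add \<Rightarrow> 'g \<Rightarrow> 'g) \<Rightarrow> 'g fps \<Rightarrow> 'g fps \<Rightarrow> 'g fps" where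
  "fps_bilin f x y = Abs_fps (\<lambda>n. \<Sum>i\<le>n. f (fps_nth x i) (fps_nth y (n - i)))"

definition deformed_bracket ::
  "('k::comm_ring_1 \<Rightarrow> 'g::ab_group_add \<Rightarrow> 'g) \<Rightarrow> ('g \<Rightarrow> 'g \<Rightarrow> 'g) \<Rightarrow> ('g \<Rightarrow> 'g \<Rightarrow> 'g)
     \<Rightarrow> 'g fps \<Rightarrow> 'g fps \<Rightarrow> 'g fps" where
  "deformed_bracket s br \<phi> x y = fps_bilin br x y + fps_scale s fps_X (fps_bilin \<phi> x y)"

definition infinitesimal_deformation ::
  "('k::comm_ring_1 \<Rightarrow> 'g::ab_group_add \<Rightarrow> 'g) \<Rightarrow> ('g \<Rightarrow> 'g \<Rightarrow> 'g) \<Rightarrow> ('g \<Rightarrow> 'g \<Rightarrow> 'g) \<Rightarrow> bool" where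
  "infinitesimal_deformation s br \<phi> \<longleftrightarrow>
     lie_bracket s br \<and> alternating_bilinear s \<phi> \<and>
     (\<forall>x y z. \<forall>n<2. fps_nth (jacobiator (deformed_bracket s br \<phi>) x y z) n = 0)"

definition real_deformation ::
  "('k::comm_ring_1 \<Rightarrow> 'g::ab_group_add \<Rightarrow> 'g) \<Rightarrow> ('g \<Rightarrow> 'g \<Rightarrow> 'g) \<Rightarrow> ('g \<Rightarrow> 'g \<Rightarrow> 'g) \<Rightarrow> bool" where
  "real_deformation s br \<phi> \<longleftrightarrow>
     lie_bracket s br \<and> alternating_bilinear s \<phi> \<and>
     lie_bracket (fps_scale s) (deformed_bracket s br \<phi>)"

section \<open>The Heisenberg algebra and the three cochains\<close>

text \<open>
  The ground field: \<^class>\<open>real_normed_field\<close> has the instances \<^typ>\<open>real\<close> and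
  \<^typ>\<open>complex\<close>, and, its norm being multiplicative, every instance is isomorphic to one of
  these two as a field (Gelfand--Mazur).  A statement for all fields of this class is thus the
  statement for the real and the complex numbers.

  In the index type \<^typ>\<open>5\<close> the numeral \<open>5\<close> denotes the same element as \<open>0\<close>, so
  \<open>1, 2, 3, 4, 5\<close> are its five distinct elements, but the order of the type is not the
  usual one of these numerals.  No definition below uses it.
\<close>

definition e :: "5 \<Rightarrow> 'k::comm_ring_1 ^ 5" where
  "e i = axis i 1"

text \<open>
  \<open>skew_map tab\<close> is the skew-symmetric bilinear map with value \<open>v\<close> on the basis
  vectors number \<open>i\<close> and \<open>j\<close> for each entry \<open>(i, j, v)\<close> of \<open>tab\<close>, and
  with value zero on pairs that are not listed.  Each unordered pair occurs at most once in the
  tables below.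
\<close>

definition skew_map :: "('n \<times> 'n \<times> ('k ^ 'n)) list \<Rightarrow> 'k::comm_ring_1 ^ 'n \<Rightarrow> 'k ^ 'n \<Rightarrow> 'k ^ 'n" where
  "skew_map tab x y =
     (\<Sum>(i, j, v) \<leftarrow> tab. (vec_nth x i * vec_nth y j - vec_nth x j * vec_nth y i) *s v)"

definition heis2 :: "'k::comm_ring_1 ^ 5 \<Rightarrow> 'k ^ 5 \<Rightarrow> 'k ^ 5" where
  "heis2 = skew_map [(1, 3, e 5), (2, 4, e 5)]"

definition phi1 :: "'k::comm_ring_1 ^ 5 \<Rightarrow> 'k ^ 5 \<Rightarrow> 'k ^ 5" where
  "phi1 = skew_map
     [(1, 3, 2 *s e 2 - 2 *s e 3), (1, 4, e 3), (2, 4, e 2), (3, 4, 2 *s e 3 - e 2)]"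

definition phi2 :: "'k::comm_ring_1 ^ 5 \<Rightarrow> 'k ^ 5 \<Rightarrow> 'k ^ 5" where
  "phi2 = skew_map
     [(1, 3, e 1), (1, 4, - e 2), (2, 3, 2 *s e 2), (3, 4, - e 4), (3, 5, - (3 *s e 5))]"

definition phi3 :: "'k::comm_ring_1 ^ 5 \<Rightarrow> 'k ^ 5 \<Rightarrow> 'k ^ 5" where
  "phi3 = skew_map
     [(1, 4, e 1), (2, 4, e 2), (3, 4, e 3), (4, 5, - (2 *s e 5))]"

text \<open>The brackets \<open>\<mu>\<^sub>t(d\<^sub>i) = [-,-] + t \<phi>\<^sub>i\<close>, on the basis vectors seen in \<open>'k^5[[t]]\<close>.\<close>

abbreviation mu_t ::
  "('k::comm_ring_1 ^ 5 \<Rightarrow> 'k ^ 5 \<Rightarrow> 'k ^ 5) \<Rightarrow> ('k ^ 5) fps \<Rightarrow> ('k ^ 5) fps \<Rightarrow> ('k ^ 5) fps" where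
  "mu_t \<phi> \<equiv> deformed_bracket (*s) heis2 \<phi>"

abbreviation E :: "5 \<Rightarrow> ('k::comm_ring_1 ^ 5) fps" where
  "E i \<equiv> fps_const (e i)"

abbreviation t_times :: "'k::comm_ring_1 ^ 5 \<Rightarrow> ('k ^ 5) fps" where
  "t_times v \<equiv> fps_scale (*s) fps_X (fps_const v)"

end

(*
  Taking coordinates identifies k^5[[t]] with k[[t]]^5, scalar multiplication included, and turns
  the k[[t]]-bilinear extension of a structure-constant table into the same table read over
  k[[t]].  The deformed bracket thus becomes heis2 + t phi_i over the ring k[[t]], and its Jacobi
  identity is an instance of the Jacobi identity of heis2 + c phi_i for an arbitrary element c of
  an arbitrary commutative ring, which is a polynomial identity in the coordinates.
*)

theory Submission
  imports Defs
begin

lemma exhaust_5: "x = 1 \<or> x = 2 \<or> x = 3 \<or> x = 4 \<or> x = 5" for x :: 5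
proof (induct x)
  case (of_int z)
  then have "0 \<le> z" and "z < 5" by simp_all
  then have "z = 0 \<or> z = 1 \<or> z = 2 \<or> z = 3 \<or> z = 4" by arith
  \<comment> \<open>The case \<open>z = 0\<close> is the disjunct \<open>x = 5\<close>, because
    \<open>5\<close> and \<open>0\<close> are the same element of this type.\<close>
  then show ?case by auto
qed

lemma forall_5: "(\<forall>i::5. P i) \<longleftrightarrow> P 1 \<and> P 2 \<and> P 3 \<and> P 4 \<and> P 5"
  by (metis exhaust_5)

lemma vec_nth_e: "vec_nth (e i) j = (if i = j then 1 else 0)"
  by (simp add: e_def axis_def)

text \<open>Each table entry contributes a fixed vector times the 2 by 2 minor of the coordinates i
  and j of x and y. Such a minor is alternating and bilinear, and both properties survive
  sums.\<close>

lemma alternating_bilinear_skew_map: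
  "alternating_bilinear (*s) (skew_map tab :: 'k::comm_ring_1 ^ 'n \<Rightarrow> _)"
proof -
  have m: "module ((*s) :: 'k \<Rightarrow> 'k ^ 'n \<Rightarrow> 'k ^ 'n)"
    by standard (simp_all add: vec_eq_iff algebra_simps)
  have "skew_map tab (x + x') y = skew_map tab x y + skew_map tab x' y"
    and "skew_map tab y (x + x') = skew_map tab y x + skew_map tab y x'"
    and "skew_map tab (c *s x) y = c *s skew_map tab x y"
    and "skew_map tab y (c *s x) = c *s skew_map tab y x"
    and "skew_map tab x x = 0" for x x' y :: "'k ^ 'n" and c
    by (induction tab) (auto simp: skew_map_def vec_eq_iff algebra_simps)
  with m show ?thesis
    by (simp add: alternating_bilinear_def module_hom_iff)
qed

lemma alternating_bilinear_add_scale: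
  fixes f g :: "'k::comm_ring_1 ^ 'n \<Rightarrow> 'k ^ 'n \<Rightarrow> 'k ^ 'n"
  assumes "alternating_bilinear (*s) f" "alternating_bilinear (*s) g"
  shows "alternating_bilinear (*s) (\<lambda>x y. f x y + c *s g x y)"
  using assms
  by (auto simp: alternating_bilinear_def module_hom_iff vec_eq_iff algebra_simps)

lemmas bracket_simps = heis2_def phi1_def phi2_def phi3_def skew_map_def vec_nth_e

lemma alternating_bilinear_brackets:
  "alternating_bilinear (*s) (heis2 :: 'k::comm_ring_1 ^ 5 \<Rightarrow> _)"
  "\<phi> \<in> {phi1, phi2, phi3 :: 'k ^ 5 \<Rightarrow> _} \<Longrightarrow> alternating_bilinear (*s) \<phi>"
  by (auto simp: heis2_def phi1_def phi2_def phi3_def alternating_bilinear_skew_map)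

text \<open>Sorted by powers of c, the jacobiator has three parts: the Jacobi identity of
  \<open>heis2\<close>, the cocycle condition for \<open>\<phi>\<close> and the Jacobi identity of
  \<open>\<phi>\<close> itself. Expansion in coordinates settles all three at once. The uses below
  are c = 0 over k and c = t over k[[t]].\<close>

lemma lie_bracket_pencil:
  fixes c :: "'k::comm_ring_1"
  assumes "\<phi> \<in> {phi1, phi2, phi3}"
  shows "lie_bracket (*s) (\<lambda>x y. heis2 x y + c *s \<phi> x y)"
proof -
  have "jacobiator (\<lambda>x y. heis2 x y + c *s \<phi> x y) x y z = 0" for x y z
    using assms
    by (elim insertE emptyE)
      (simp_all add: jacobiator_def vec_eq_iff forall_5 bracket_simps algebra_simps)
  then show ?thesis
    using assms
    by (simp add: lie_bracket_def alternating_bilinear_add_scale alternating_bilinear_brackets)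
qed

lemma lie_bracket_heis2: "lie_bracket (*s) (heis2 :: 'k::comm_ring_1 ^ 5 \<Rightarrow> _)"
  using lie_bracket_pencil[of phi1 "0 :: 'k"] by simp

lemma two_cocycle_phi:
  assumes "\<phi> \<in> {phi1, phi2, phi3 :: 'k::comm_ring_1 ^ 5 \<Rightarrow> _}"
  shows "two_cocycle (*s) heis2 \<phi>"
proof -
  have "ce_diff2 heis2 \<phi> x y z = 0" for x y z
    using assms
    by (elim insertE emptyE)
      (simp_all add: ce_diff2_def vec_eq_iff forall_5 bracket_simps algebra_simps)
  then show ?thesis
    using assms by (simp add: two_cocycle_def lie_bracket_heis2 alternating_bilinear_brackets)
qed

definition fps_coords :: "('k ^ 'n) fps \<Rightarrow> 'k fps ^ 'n" where
  "fps_coords x = vec_lambda (\<lambda>i. Abs_fps (\<lambda>n. vec_nth (fps_nth x n) i))"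

lemma fps_coords_nth [simp]:
  "fps_nth (vec_nth (fps_coords x) i) n = vec_nth (fps_nth x n) i"
  by (simp add: fps_coords_def)

text \<open>Injectivity pulls identities in k[[t]]^n back to k^n[[t]].\<close>

lemma fps_coords_eq_iff: "fps_coords x = fps_coords y \<longleftrightarrow> x = y"
  by (auto simp: fps_eq_iff vec_eq_iff)

lemma fps_coords_0: "fps_coords 0 = 0"
  by (simp add: fps_eq_iff vec_eq_iff)

lemma fps_coords_add: "fps_coords (x + y) = fps_coords x + fps_coords y"
  by (simp add: fps_eq_iff vec_eq_iff)

lemma fps_coords_scale: "fps_coords (fps_scale (*s) a x) = a *s fps_coords x"
  by (simp add: fps_eq_iff vec_eq_iff fps_scale_def fps_mult_nth atLeast0AtMost)

lemma fps_coords_const: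
  "fps_coords (fps_const v) = vec_lambda (\<lambda>i. fps_const (vec_nth v i))"
  by (simp add: fps_eq_iff vec_eq_iff)

text \<open>Both sides are additive in the table, which reduces the claim to a single entry. There
  each product of coordinates turns into a Cauchy product of coordinate series.\<close>

lemma fps_coords_bilin_skew_map:
  "fps_coords (fps_bilin (skew_map tab) x y) =
    skew_map (map (\<lambda>(i, j, v). (i, j, fps_coords (fps_const v))) tab) (fps_coords x) (fps_coords y)"
proof (induction tab)
  case Nil
  show ?case by (simp add: fps_bilin_def skew_map_def fps_coords_0 fps_eq_iff vec_eq_iff)
next
  case (Cons a tab)
  obtain i j v where a: "a = (i, j, v)" by (cases a)
  have "fps_bilin (skew_map (a # tab)) x y =
      fps_bilin (skew_map [a]) x y + fps_bilin (skew_map tab) x y"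
    by (simp add: fps_bilin_def skew_map_def fps_eq_iff sum.distrib)
  moreover have "fps_coords (fps_bilin (skew_map [a]) x y) =
      skew_map [(i, j, fps_coords (fps_const v))] (fps_coords x) (fps_coords y)"
  proof -
    \<comment> \<open>The coordinates of a table vector are constant series, so they act
      coefficientwise and move inside the Cauchy sum.\<close>
    have "fps_nth (f * g) n * c = (\<Sum>i\<le>n. fps_nth f i * fps_nth g (n - i) * c)"
      for f g :: "'a fps" and c n
      by (simp add: fps_mult_nth atLeast0AtMost sum_distrib_right)
    then show ?thesis
      by (simp add: a fps_eq_iff vec_eq_iff fps_bilin_def skew_map_def fps_coords_const
          left_diff_distrib sum_subtractf)
  qed
  ultimately show ?case
    using Cons.IH by (simp add: a fps_coords_add) (simp add: skew_map_def)
qed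

lemma fps_coords_const_e:
  "fps_coords (fps_const (e i)) = (e i :: 'k::comm_ring_1 fps ^ 5)"
  by (simp add: fps_eq_iff vec_eq_iff vec_nth_e)

text \<open>The table vectors are integer combinations of basis vectors, so reading them as constant
  series gives the same tables over k[[t]]. On the right the maps are the instances over that
  ring.\<close>

lemma fps_coords_bracket:
  fixes x y :: "('k::comm_ring_1 ^ 5) fps"
  shows "fps_coords (fps_bilin heis2 x y) = heis2 (fps_coords x) (fps_coords y)"
    and "fps_coords (fps_bilin phi1 x y) = phi1 (fps_coords x) (fps_coords y)"
    and "fps_coords (fps_bilin phi2 x y) = phi2 (fps_coords x) (fps_coords y)"
    and "fps_coords (fps_bilin phi3 x y) = phi3 (fps_coords x) (fps_coords y)"
proof -
  have "fps_coords (fps_const (v - w)) = fps_coords (fps_const v) - fps_coords (fps_const w)"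
    "fps_coords (fps_const (- v)) = - fps_coords (fps_const v)"
    "fps_coords (fps_const (numeral m *s v)) = numeral m *s fps_coords (fps_const v)"
    for v w :: "'k ^ 5" and m
    by (simp_all add: fps_eq_iff vec_eq_iff numeral_fps_const)
  note const = this fps_coords_const_e
  show "fps_coords (fps_bilin heis2 x y) = heis2 (fps_coords x) (fps_coords y)"
    and "fps_coords (fps_bilin phi1 x y) = phi1 (fps_coords x) (fps_coords y)"
    and "fps_coords (fps_bilin phi2 x y) = phi2 (fps_coords x) (fps_coords y)"
    and "fps_coords (fps_bilin phi3 x y) = phi3 (fps_coords x) (fps_coords y)"
    unfolding heis2_def phi1_def phi2_def phi3_def fps_coords_bilin_skew_map
    by (simp_all add: const)
qed

lemma lie_bracket_mu_t:
  assumes \<phi>: "\<phi> \<in> {phi1, phi2, phi3 :: 'k::comm_ring_1 ^ 5 \<Rightarrow> _}"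
  shows "lie_bracket (fps_scale (*s)) (mu_t \<phi>)"
proof -
  \<comment> \<open>\<open>\<psi>\<close> is the cochain with the same table as
    \<open>\<phi>\<close>, taken over k[[t]]; it needs a variable of its own because the type of
    \<open>\<phi>\<close> is fixed.\<close>
  obtain \<psi> :: "'k fps ^ 5 \<Rightarrow> 'k fps ^ 5 \<Rightarrow> 'k fps ^ 5" where \<psi>: "\<psi> \<in> {phi1, phi2, phi3}"
    and coords: "\<And>x y. fps_coords (mu_t \<phi> x y) =
      heis2 (fps_coords x) (fps_coords y) + fps_X *s \<psi> (fps_coords x) (fps_coords y)"
    using \<phi> unfolding deformed_bracket_def fps_coords_add fps_coords_scale fps_coords_bracket(1)
    by (elim insertE emptyE) (metis fps_coords_bracket insertCI)+
  from lie_bracket_pencil[OF \<psi>, of fps_X]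
  have "alternating_bilinear (*s) (\<lambda>x y. heis2 x y + fps_X *s \<psi> x y)"
    and jac: "\<And>x y z. jacobiator (\<lambda>x y. heis2 x y + fps_X *s \<psi> x y) x y z = 0"
    by (auto simp: lie_bracket_def)
  \<comment> \<open>This includes the module axioms for k^5[[t]] over k[[t]], which are pulled back
    from k[[t]]^5 together with bilinearity.\<close>
  then have "alternating_bilinear (fps_scale (*s)) (mu_t \<phi>)"
    unfolding alternating_bilinear_def module_hom_iff module_def
    by (simp add: coords fps_coords_0 fps_coords_add fps_coords_scale flip: fps_coords_eq_iff)
  moreover have "jacobiator (mu_t \<phi>) x y z = 0" for x y z
    using jac[of "fps_coords x" "fps_coords y" "fps_coords z"]
    by (simp add: jacobiator_def coords fps_coords_0 fps_coords_add flip: fps_coords_eq_iff)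
  ultimately show ?thesis
    by (simp add: lie_bracket_def)
qed

text \<open>In positive degree every summand of the Cauchy product has a zero argument, where a
  bilinear map vanishes.\<close>

lemma fps_bilin_const:
  assumes "alternating_bilinear s f"
  shows "fps_bilin f (fps_const v) (fps_const w) = fps_const (f v w)"
proof -
  have "f 0 y = 0" "f y 0 = 0" for y
    using assms module_hom.zero unfolding alternating_bilinear_def by blast+
  then show ?thesis
    by (auto simp: fps_bilin_def fps_eq_iff intro!: sum.neutral)
qed

text \<open>Stated separately for each cochain to give unconditional rewrite rules.\<close>

lemma mu_t_E:
  shows "mu_t phi1 (E i) (E j) = fps_const (heis2 (e i) (e j)) + t_times (phi1 (e i) (e j))"
    and "mu_t phi2 (E i) (E j) = fps_const (heis2 (e i) (e j)) + t_times (phi2 (e i) (e j))"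
    and "mu_t phi3 (E i) (E j) = fps_const (heis2 (e i) (e j)) + t_times (phi3 (e i) (e j))"
  by (simp_all add: deformed_bracket_def fps_bilin_const[OF alternating_bilinear_brackets(1)]
      fps_bilin_const[OF alternating_bilinear_brackets(2)])

text \<open>The coefficients of 1 and t are v and w. Together with \<open>mu_t_E\<close> this makes
  the list of nonzero brackets a finite check over k.\<close>

lemma const_plus_t_times_eq_0_iff:
  fixes v w :: "'k::comm_ring_1 ^ 5"
  shows "fps_const v + t_times w = 0 \<longleftrightarrow> v = 0 \<and> w = 0"
proof
  assume "fps_const v + t_times w = 0"
  moreover have "fps_nth (fps_const v + t_times w) 0 = v" "fps_nth (fps_const v + t_times w) 1 = w"
    by (simp_all add: fps_scale_def vec_eq_iff)
  ultimately show "v = 0 \<and> w = 0" by simp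
qed (simp add: fps_scale_def fps_eq_iff)

theorem theorem4p1:
  shows
    "(\<forall>\<phi> \<in> {phi1, phi2, phi3 :: 'k::real_normed_field ^ 5 \<Rightarrow> 'k ^ 5 \<Rightarrow> 'k ^ 5}.
        two_cocycle (*s) heis2 \<phi> \<and>
        infinitesimal_deformation (*s) heis2 \<phi> \<and>
        real_deformation (*s) heis2 \<phi>) \<and>
      (mu_t phi1 (E 1) (E 3) = (E 5 + t_times (2 *s e 2 - 2 *s e 3) :: ('k ^ 5) fps) \<and>
       mu_t phi1 (E 1) (E 4) = (t_times (e 3) :: ('k ^ 5) fps) \<and>
       mu_t phi1 (E 2) (E 4) = (E 5 + t_times (e 2) :: ('k ^ 5) fps) \<and>
       mu_t phi1 (E 3) (E 4) = (t_times (2 *s e 3 - e 2) :: ('k ^ 5) fps) \<and>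
       {(i, j). mu_t phi1 (E i) (E j) \<noteq> (0 :: ('k ^ 5) fps)}
         = {(1, 3), (1, 4), (2, 4), (3, 4)} \<union> {(1, 3), (1, 4), (2, 4), (3, 4)}\<inverse>) \<and>
      (mu_t phi2 (E 1) (E 3) = (E 5 + t_times (e 1) :: ('k ^ 5) fps) \<and>
       mu_t phi2 (E 1) (E 4) = (t_times (- e 2) :: ('k ^ 5) fps) \<and>
       mu_t phi2 (E 2) (E 3) = (t_times (2 *s e 2) :: ('k ^ 5) fps) \<and>
       mu_t phi2 (E 2) (E 4) = (E 5 :: ('k ^ 5) fps) \<and>
       mu_t phi2 (E 3) (E 4) = (t_times (- e 4) :: ('k ^ 5) fps) \<and>
       mu_t phi2 (E 3) (E 5) = (t_times (- (3 *s e 5)) :: ('k ^ 5) fps) \<and>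
       {(i, j). mu_t phi2 (E i) (E j) \<noteq> (0 :: ('k ^ 5) fps)}
         = {(1, 3), (1, 4), (2, 3), (2, 4), (3, 4), (3, 5)} \<union> {(1, 3), (1, 4), (2, 3), (2, 4), (3, 4), (3, 5)}\<inverse>) \<and>
      (mu_t phi3 (E 1) (E 3) = (E 5 :: ('k ^ 5) fps) \<and>
       mu_t phi3 (E 1) (E 4) = (t_times (e 1) :: ('k ^ 5) fps) \<and>
       mu_t phi3 (E 2) (E 4) = (E 5 + t_times (e 2) :: ('k ^ 5) fps) \<and>
       mu_t phi3 (E 3) (E 4) = (t_times (e 3) :: ('k ^ 5) fps) \<and>
       mu_t phi3 (E 4) (E 5) = (t_times (- (2 *s e 5)) :: ('k ^ 5) fps) \<and>
       {(i, j). mu_t phi3 (E i) (E j) \<noteq> (0 :: ('k ^ 5) fps)}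
         = {(1, 3), (1, 4), (2, 4), (3, 4), (4, 5)} \<union> {(1, 3), (1, 4), (2, 4), (3, 4), (4, 5)}\<inverse>)"
proof -
  have cochains: "\<forall>\<phi> \<in> {phi1, phi2, phi3 :: 'k ^ 5 \<Rightarrow> _}.
    two_cocycle (*s) heis2 \<phi> \<and> infinitesimal_deformation (*s) heis2 \<phi> \<and>
    real_deformation (*s) heis2 \<phi>"
  proof
    fix \<phi> assume \<phi>: "\<phi> \<in> {phi1, phi2, phi3 :: 'k ^ 5 \<Rightarrow> _}"
    note lie = lie_bracket_mu_t[OF \<phi>]
    \<comment> \<open>The jacobiator vanishes in every order, in particular in orders 0 and 1, which
      is the infinitesimal claim.\<close>
    then have "jacobiator (mu_t \<phi>) x y z = 0" for x y z
      by (simp add: lie_bracket_def)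
    with lie show "two_cocycle (*s) heis2 \<phi> \<and> infinitesimal_deformation (*s) heis2 \<phi> \<and>
        real_deformation (*s) heis2 \<phi>"
      using two_cocycle_phi[OF \<phi>]
      by (simp add: two_cocycle_def infinitesimal_deformation_def real_deformation_def)
  qed
  have nonzero1: "{(i, j). mu_t phi1 (E i) (E j) \<noteq> (0 :: ('k ^ 5) fps)}
      = {(1, 3), (1, 4), (2, 4), (3, 4)} \<union> {(1, 3), (1, 4), (2, 4), (3, 4)}\<inverse>"
    unfolding set_eq_iff split_paired_All mu_t_E const_plus_t_times_eq_0_iff
    by (simp add: forall_5 bracket_simps vec_eq_iff)
  \<comment> \<open>Characteristic zero enters here: the brackets at (2, 3) and (3, 5) are 2t and
    -3t times a basis vector. The pair (4, 5) of \<open>phi3\<close> is similar.\<close>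
  have nonzero2: "{(i, j). mu_t phi2 (E i) (E j) \<noteq> (0 :: ('k ^ 5) fps)}
      = {(1, 3), (1, 4), (2, 3), (2, 4), (3, 4), (3, 5)} \<union> {(1, 3), (1, 4), (2, 3), (2, 4), (3, 4), (3, 5)}\<inverse>"
    unfolding set_eq_iff split_paired_All mu_t_E const_plus_t_times_eq_0_iff
    by (simp add: forall_5 bracket_simps vec_eq_iff)
  have nonzero3: "{(i, j). mu_t phi3 (E i) (E j) \<noteq> (0 :: ('k ^ 5) fps)}
      = {(1, 3), (1, 4), (2, 4), (3, 4), (4, 5)} \<union> {(1, 3), (1, 4), (2, 4), (3, 4), (4, 5)}\<inverse>"
    unfolding set_eq_iff split_paired_All mu_t_E const_plus_t_times_eq_0_iff
    by (simp add: forall_5 bracket_simps vec_eq_iff)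
  \<comment> \<open>This removes the t-term where only \<open>heis2\<close> contributes: (2, 4) for
    \<open>phi2\<close> and (1, 3) for \<open>phi3\<close>.\<close>
  have t0: "fps_scale (*s) fps_X (0 :: ('k ^ 5) fps) = 0"
    by (simp add: fps_scale_def fps_eq_iff)
  show ?thesis
    by (intro conjI cochains nonzero1 nonzero2 nonzero3; unfold mu_t_E)
      (simp_all add: bracket_simps t0)
qed

end
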